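(* Let $\alpha,\beta,\mu\in\mathbb C$ and let $\mathcal F_{\alpha,\beta,\mu}(w,\partial_w)$ be the hypergeometric operator in Lie-algebraic parameters. After each of the following substitutions $w=w(v)$, the operator $\mathcal F_{\alpha,\beta,\mu}(w,\partial_w)$, rewritten in the variable $v$, equals each of the four operators listed (as an identity of differential operators on functions of $v$). (1) $w=v$: $\mathcal F_{\alpha,\beta,\mu}(v,\partial_v)$; $(-v)^{-\alpha}(v-1)^{-\beta}\,\mathcal F_{-\alpha,-\beta,\mu}(v,\partial_v)\,(-v)^{\alpha}(v-1)^{\beta}$; $(v-1)^{-\beta}\,\mathcal F_{\alpha,-\beta,-\mu}(v,\partial_v)\,(v-1)^{\beta}$; $(-v)^{-\alpha}\,\mathcal F_{-\alpha,\beta,-\mu}(v,\partial_v)\,(-v)^{\alpha}$. (2) $w=1-v$: $\mathcal F_{\beta,\alpha,\mu}(v,\partial_v)$; $(v-1)^{-\alpha}(-v)^{-\beta}\,\mathcal F_{-\beta,-\alpha,\mu}(v,\partial_v)\,(v-1)^{\alpha}(-v)^{\beta}$; $(v-1)^{-\alpha}\,\mathcal F_{\beta,-\alpha,-\mu}(v,\partial_v)\,(v-1)^{\alpha}$; $(-v)^{-\beta}\,\mathcal F_{-\beta,\alpha,-\mu}(v,\partial_v)\,(-v)^{\beta}$. (3) $w=\frac1v$: $(-v)^{\frac{\alpha+\beta+\mu+1}{2}}(-v)\mathcal F_{\mu,\beta,\alpha}(v,\partial_v)(-v)^{\frac{-\alpha-\beta-\mu-1}{2}}$; $(-v)^{\frac{\alpha+\beta-\mu+1}{2}}(v-1)^{-\beta}(-v)\mathcal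 F_{-\mu,-\beta,\alpha}(v,\partial_v)(-v)^{\frac{-\alpha-\beta+\mu-1}{2}}(v-1)^{\beta}$; $(-v)^{\frac{\alpha+\beta+\mu+1}{2}}(v-1)^{-\beta}(-v)\mathcal F_{\mu,-\beta,-\alpha}(v,\partial_v)(-v)^{\frac{-\alpha-\beta-\mu-1}{2}}(v-1)^{\beta}$; $(-v)^{\frac{\alpha+\beta-\mu+1}{2}}(-v)\mathcal F_{-\mu,\beta,-\alpha}(v,\partial_v)(-v)^{\frac{-\alpha-\beta+\mu-1}{2}}$. (4) $w=\frac{v-1}{v}$: $(-v)^{\frac{\alpha+\beta+\mu+1}{2}}(-v)\mathcal F_{\mu,\alpha,\beta}(v,\partial_v)(-v)^{\frac{-\alpha-\beta-\mu-1}{2}}$; $(-v)^{\frac{\alpha+\beta-\mu+1}{2}}(v-1)^{-\alpha}(-v)\mathcal F_{-\mu,-\alpha,\beta}(v,\partial_v)(-v)^{\frac{-\alpha-\beta+\mu-1}{2}}(v-1)^{\alpha}$; $(-v)^{\frac{\alpha+\beta+\mu+1}{2}}(v-1)^{-\alpha}(-v)\mathcal F_{\mu,-\alpha,-\beta}(v,\partial_v)(-v)^{\frac{-\alpha-\beta-\mu-1}{2}}(v-1)^{\alpha}$; $(-v)^{\frac{\alpha+\beta-\mu+1}{2}}(-v)\mathcal F_{-\mu,\alpha,-\beta}(v,\partial_v)(-v)^{\frac{-\alpha-\beta+\mu-1}{2}}$. (5) $w=\frac1{1-v}$: $(v-1)^{\frac{\alpha+\beta+\mu+1}{2}}(v-1)\mathcal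 F_{\beta,\mu,\alpha}(v,\partial_v)(v-1)^{\frac{-\alpha-\beta-\mu-1}{2}}$; $(-v)^{-\beta}(v-1)^{\frac{\alpha+\beta-\mu+1}{2}}(v-1)\mathcal F_{-\beta,-\mu,\alpha}(v,\partial_v)(-v)^{\beta}(v-1)^{\frac{-\alpha-\beta+\mu-1}{2}}$; $(v-1)^{\frac{\alpha+\beta-\mu+1}{2}}(v-1)\mathcal F_{\beta,-\mu,-\alpha}(v,\partial_v)(v-1)^{\frac{-\alpha-\beta+\mu-1}{2}}$; $(-v)^{-\beta}(v-1)^{\frac{\alpha+\beta+\mu+1}{2}}(v-1)\mathcal F_{-\beta,\mu,-\alpha}(v,\partial_v)(-v)^{\beta}(v-1)^{\frac{-\alpha-\beta-\mu-1}{2}}$. (6) $w=\frac{v}{v-1}$: $(v-1)^{\frac{\alpha+\beta+\mu+1}{2}}(v-1)\mathcal F_{\alpha,\mu,\beta}(v,\partial_v)(v-1)^{\frac{-\alpha-\beta-\mu-1}{2}}$; $(-v)^{-\alpha}(v-1)^{\frac{\alpha+\beta-\mu+1}{2}}(v-1)\mathcal F_{-\alpha,-\mu,\beta}(v,\partial_v)(-v)^{\alpha}(v-1)^{\frac{-\alpha-\beta+\mu-1}{2}}$; $(v-1)^{\frac{\alpha+\beta-\mu+1}{2}}(v-1)\mathcal F_{\alpha,-\mu,-\beta}(v,\partial_v)(v-1)^{\frac{-\alpha-\beta+\mu-1}{2}}$; $(-v)^{-\alpha}(v-1)^{\frac{\alpha+\beta+\mu+1}{2}}(v-1)\mathcal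 F_{-\alpha,\mu,-\beta}(v,\partial_v)(-v)^{\alpha}(v-1)^{\frac{-\alpha-\beta-\mu-1}{2}}$.
   Context: For $\alpha,\beta,\mu\in\mathbb C$ the hypergeometric (${}_2\mathcal F_1$) operator in Lie-algebraic parameters is $$\mathcal F_{\alpha,\beta,\mu}(w,\partial_w):=w(1-w)\partial_w^2-\big((1+\alpha)(w-1)+(1+\beta)w\big)\partial_w-\tfrac14(\alpha+\beta+1)^2+\tfrac14\mu^2 .$$ An expression $p\,\mathcal F\,q$ with functions $p,q$ means the composition: multiply by $q$, apply $\mathcal F$, multiply by $p$. The variable $v$ ranges over a simply connected open subset of $\mathbb C\setminus\{0,1\}$ on which branches of $\log(-v)$ and $\log(v-1)$ are fixed; all powers of $-v$ and of $v-1$ in an expression use these same branches. *)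

theory Defs
  imports "HOL-Complex_Analysis.Complex_Analysis"
begin

type_synonym fun_op = "(complex \<Rightarrow> complex) \<Rightarrow> (complex \<Rightarrow> complex)"

text \<open>
  The formal expression \<open>\<F>\<^sub>\<alpha>\<^sub>,\<^sub>\<beta>\<^sub>,\<^sub>\<mu>(w, \<partial>)\<close>, with an arbitrary function \<open>w\<close> (acting by
  multiplication) in place of the variable and an arbitrary operator \<open>D\<close> in place of \<open>\<partial>\<^sub>w\<close>.
\<close>

definition hyp_expr ::
  "complex \<Rightarrow> complex \<Rightarrow> complex \<Rightarrow> (complex \<Rightarrow> complex) \<Rightarrow> fun_op \<Rightarrow> fun_op" where
  "hyp_expr \<alpha> \<beta> \<mu> w D f = (\<lambda>v.
     w v * (1 - w v) * D (D f) v
     - ((1 + \<alpha>) * (w v - 1) + (1 + \<beta>) * w v) * D f v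
     - 1/4 * (\<alpha> + \<beta> + 1)\<^sup>2 * f v + 1/4 * \<mu>\<^sup>2 * f v)"

definition hyp_op :: "complex \<Rightarrow> complex \<Rightarrow> complex \<Rightarrow> fun_op" where
  "hyp_op \<alpha> \<beta> \<mu> = hyp_expr \<alpha> \<beta> \<mu> (\<lambda>v. v) deriv"

text \<open>
  Under a substitution \<open>w = w(v)\<close> the derivation \<open>\<partial>\<^sub>w\<close> becomes \<open>w'(v)\<inverse> \<partial>\<^sub>v\<close>.
\<close>

definition deriv_wrt :: "(complex \<Rightarrow> complex) \<Rightarrow> fun_op" where
  "deriv_wrt w f = (\<lambda>v. deriv f v / deriv w v)"

definition hyp_op_subst ::
  "complex \<Rightarrow> complex \<Rightarrow> complex \<Rightarrow> (complex \<Rightarrow> complex) \<Rightarrow> fun_op" where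
  "hyp_op_subst \<alpha> \<beta> \<mu> w = hyp_expr \<alpha> \<beta> \<mu> w (deriv_wrt w)"

definition mult_op :: "(complex \<Rightarrow> complex) \<Rightarrow> fun_op" where
  "mult_op p f = (\<lambda>v. p v * f v)"

definition log_branch_on ::
  "complex set \<Rightarrow> (complex \<Rightarrow> complex) \<Rightarrow> (complex \<Rightarrow> complex) \<Rightarrow> bool" where
  "log_branch_on S g L \<longleftrightarrow> continuous_on S L \<and> (\<forall>v\<in>S. exp (L v) = g v)"

text \<open>
  Multiplication by the power \<open>g\<^sup>a\<close> determined by a branch \<open>L\<close> of \<open>log g\<close>.
\<close>

definition pow_op :: "(complex \<Rightarrow> complex) \<Rightarrow> complex \<Rightarrow> fun_op" where
  "pow_op L a = mult_op (\<lambda>v. exp (a * L v))"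

definition op_eq_on :: "complex set \<Rightarrow> fun_op \<Rightarrow> fun_op \<Rightarrow> bool" where
  "op_eq_on S A B \<longleftrightarrow> (\<forall>f. f holomorphic_on S \<longrightarrow> (\<forall>v\<in>S. A f v = B f v))"

text \<open>
  The rewritten operator is the original one conjugated by the pullback \<open>g \<mapsto> g \<circ> w\<close>.
\<close>

lemma hyp_op_subst_comp:
  assumes "open S" "open T" "w holomorphic_on S" "g holomorphic_on T" "w ` S \<subseteq> T"
    and nz: "\<And>v. v \<in> S \<Longrightarrow> deriv w v \<noteq> 0" and "v \<in> S"
  shows "hyp_op_subst \<alpha> \<beta> \<mu> w (g \<circ> w) v = hyp_op \<alpha> \<beta> \<mu> g (w v)"
proof -
  have chain: "deriv_wrt w (h \<circ> w) x = deriv h (w x)"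
    if "h holomorphic_on T" "x \<in> S" for h x
  proof -
    have "w field_differentiable at x"
      using assms(1,3) that(2) by (meson holomorphic_on_imp_differentiable_at)
    moreover have "h field_differentiable at (w x)"
      using assms(2,5) that by (meson holomorphic_on_imp_differentiable_at image_subset_iff)
    ultimately show ?thesis
      using nz[OF that(2)] by (simp add: deriv_wrt_def deriv_chain)
  qed
  have dg: "deriv g holomorphic_on T"
    using assms(2,4) by (rule holomorphic_deriv[rotated])
  have "eventually (\<lambda>x. deriv_wrt w (g \<circ> w) x = (deriv g \<circ> w) x) (nhds v)"
    using assms(1,7) chain[OF assms(4)] by (auto simp: eventually_nhds)
  then have "deriv (deriv_wrt w (g \<circ> w)) v = deriv (deriv g \<circ> w) v"
    by (rule deriv_cong_ev) simp
  then have "deriv_wrt w (deriv_wrt w (g \<circ> w)) v = deriv_wrt w (deriv g \<circ> w) v"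
    by (simp add: deriv_wrt_def)
  then show ?thesis
    using chain[OF assms(4,7)] chain[OF dg assms(7)]
    by (simp add: hyp_op_subst_def hyp_op_def hyp_expr_def)
qed

end

theory Submission
  imports Defs
begin

text \<open>
  Conjugating the hypergeometric operator with parameters \<open>A, B, M\<close> by \<open>(-v)\<^sup>a (v - 1)\<^sup>b\<close> gives
  an operator that depends only on \<open>A + 2 a\<close>, \<open>B + 2 b\<close> and the squares of \<open>A\<close>, \<open>B\<close> and \<open>M\<close>.  Its
  first order part fixes \<open>A + 2 a\<close> and \<open>B + 2 b\<close>, and the four choices of signs of
  \<open>A\<close> and \<open>B\<close> then give the four conjugates of each group.  It remains to
  identify, for each of the six substitutions, the substituted operator with one operator of this
  form, up to the factor \<open>1\<close>, \<open>-v\<close> or \<open>v - 1\<close>.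
\<close>

definition gauged_hyp_op :: "complex \<Rightarrow> complex \<Rightarrow> complex \<Rightarrow> complex \<Rightarrow> complex \<Rightarrow> fun_op" where
  "gauged_hyp_op p q A B M f = (\<lambda>v.
     v * (1 - v) * deriv (deriv f) v
     - ((1 + p) * (v - 1) + (1 + q) * v) * deriv f v
     + ((p\<^sup>2 - A\<^sup>2) / (4 * v) - (q\<^sup>2 - B\<^sup>2) / (4 * (v - 1)) + (M\<^sup>2 - (p + q + 1)\<^sup>2) / 4) * f v)"

text \<open>The operator has exponents \<open>(- p \<plusminus> A) / 2\<close> at \<open>0\<close>,
  \<open>(- q \<plusminus> B) / 2\<close> at \<open>1\<close> and, in powers of
  \<open>1 / v\<close>, \<open>(p + q + 1 \<plusminus> M) / 2\<close> at infinity. A change of sign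
  only swaps the two exponents at one singular point. As simp rules these equations bring all four
  conjugates of a group to one normal form.\<close>

lemma gauged_hyp_op_minus [simp]:
  "gauged_hyp_op p q (- A) B M = gauged_hyp_op p q A B M"
  "gauged_hyp_op p q A (- B) M = gauged_hyp_op p q A B M"
  "gauged_hyp_op p q A B (- M) = gauged_hyp_op p q A B M"
  by (simp_all add: gauged_hyp_op_def fun_eq_iff)

section \<open>Derivatives of branches of the logarithm\<close>

text \<open>A branch is only known to be continuous, so its differentiability has to be derived: the
  difference quotient of \<open>L\<close> is that of \<open>g = exp \<circ> L\<close> divided by a
  divided difference of \<open>exp\<close>, and continuity of \<open>L\<close> gives the limit of
  the divisor.\<close>

lemma log_branch_on_has_field_derivative:
  assumes "open S" "log_branch_on S g L" "v \<in> S" "(g has_field_derivative g') (at v)"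
  shows "(L has_field_derivative g' / g v) (at v)"
proof -
  have L: "continuous_on S L" "\<And>z. z \<in> S \<Longrightarrow> exp (L z) = g z"
    using assms(2) by (auto simp: log_branch_on_def)
  have lim: "(L \<longlongrightarrow> L v) (at v)"
    using L(1) assms(1,3) by (simp add: continuous_on_eq_continuous_at isCont_def)
  \<comment> \<open>The divided difference of \<open>exp\<close> at \<open>L v\<close>, completed by
    the derivative on the diagonal. This makes \<open>q\<close> continuous there and keeps the
    factorization of \<open>g z - g v\<close> valid even where \<open>L z = L v\<close>.\<close>
  define q where "q = (\<lambda>w. if w = L v then exp (L v) else (exp w - exp (L v)) / (w - L v))"
  have "((\<lambda>w. (exp w - exp (L v)) / (w - L v)) \<longlongrightarrow> exp (L v)) (at (L v))"
    using DERIV_exp[of "L v"] by (simp add: has_field_derivative_iff)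
  then have "(q \<longlongrightarrow> q (L v)) (at (L v))"
    by (auto simp: q_def elim!: Lim_transform_eventually
        intro: eventually_mono[OF eventually_neq_at_within])
  then have "isCont q (L v)"
    by (simp add: isCont_def)
  then have q: "((\<lambda>z. q (L z)) \<longlongrightarrow> g v) (at v)"
    using isCont_tendsto_compose[OF _ lim] L(2)[OF assms(3)] by (fastforce simp: q_def)
  have nz: "g v \<noteq> 0"
    using L(2)[OF assms(3)] by (metis exp_not_eq_zero)
  have ev: "eventually (\<lambda>z. z \<in> S) (at v)"
    using assms(1,3) by (simp add: eventually_at_in_open')
  have "((\<lambda>z. (g z - g v) / (z - v) / q (L z)) \<longlongrightarrow> g' / g v) (at v)"
    using assms(4) q nz by (intro tendsto_divide) (auto simp: has_field_derivative_iff)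
  \<comment> \<open>Since \<open>q (L z)\<close> tends to \<open>g v \<noteq> 0\<close>, it is
    nonzero near \<open>v\<close> and may be divided out.\<close>
  moreover have "eventually (\<lambda>z. (g z - g v) / (z - v) / q (L z) = (L z - L v) / (z - v)) (at v)"
    using ev tendsto_imp_eventually_ne[OF q nz]
  proof eventually_elim
    case (elim z)
    have "g z - g v = q (L z) * (L z - L v)"
      using elim L(2)[of z] L(2)[OF assms(3)] by (auto simp: q_def)
    then show ?case
      using elim by simp
  qed
  ultimately show ?thesis
    unfolding has_field_derivative_iff by (rule Lim_transform_eventually)
qed

section \<open>Second derivatives after a change of variable\<close>

text \<open>With \<open>r = 1 / w'\<close> the new derivation is \<open>r\<close> times the old one,
  and the product rule gives its square. Prescribing \<open>r\<close> instead of \<open>w'\<close>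
  keeps everything polynomial, because \<open>r\<close> is a polynomial for each of the six
  substitutions. The formula for the inner derivative holds on the whole open set, so it can be
  differentiated again.\<close>

lemma deriv_wrt_deriv_wrt:
  assumes "open S" "f holomorphic_on S" "v \<in> S" "(r has_field_derivative r') (at v)"
    and w: "\<And>z. z \<in> S \<Longrightarrow> (w has_field_derivative inverse (r z)) (at z)"
  shows "deriv_wrt w (deriv_wrt w f) v = r v * (r v * deriv (deriv f) v + r' * deriv f v)"
proof -
  have dw: "deriv_wrt w h z = r z * deriv h z" if "z \<in> S" for h z
    using DERIV_imp_deriv[OF w[OF that]] by (simp add: deriv_wrt_def divide_inverse)
  have "(deriv f has_field_derivative deriv (deriv f) v) (at v)"
    using assms(1-3) by (meson holomorphic_deriv holomorphic_derivI)
  with assms(4) have "((\<lambda>z. r z * deriv f z) has_field_derivative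
      r' * deriv f v + deriv (deriv f) v * r v) (at v)"
    by (rule DERIV_mult)
  then have "(deriv_wrt w f has_field_derivative
      r' * deriv f v + deriv (deriv f) v * r v) (at v)"
    by (rule has_field_derivative_transform_within_open[OF _ assms(1,3)]) (simp add: dw)
  then have "deriv (deriv_wrt w f) v = r' * deriv f v + deriv (deriv f) v * r v"
    by (rule DERIV_imp_deriv)
  then show ?thesis
    by (simp add: dw[OF assms(3)] mult.commute)
qed

section \<open>Conjugation by powers of \<open>-v\<close> and \<open>v - 1\<close>\<close>

text \<open>Conjugation replaces the derivation \<open>d/dv\<close> by \<open>d/dv + \<phi>\<close>,
  where \<open>\<phi>\<close> is the logarithmic derivative of the power factor. The poles of
  \<open>\<phi>\<close> lie at the zeros of the leading coefficient \<open>v (1 - v)\<close>, so the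
  first order coefficient stays polynomial and the zeroth order one acquires at most simple
  poles.\<close>

lemma hyp_op_conjugate:
  assumes S: "open S" "S \<subseteq> - {0, 1}"
    and L: "log_branch_on S (\<lambda>v. - v) L0" "log_branch_on S (\<lambda>v. v - 1) L1"
    and f: "f holomorphic_on S" and v: "v \<in> S"
  shows "hyp_op A B M (\<lambda>z. exp (a * L0 z + b * L1 z) * f z) v =
    exp (a * L0 v + b * L1 v) * gauged_hyp_op (A + 2 * a) (B + 2 * b) A B M f v"
proof -
  define h where "h = (\<lambda>z. exp (a * L0 z + b * L1 z))"
  define \<phi> where "\<phi> = (\<lambda>z. a / z + b / (z - 1))"
  have nz: "z \<noteq> 0" "z - 1 \<noteq> 0" if "z \<in> S" for z
    using S(2) that by auto
  \<comment> \<open>The derivative \<open>-1\<close> of \<open>-v\<close> cancels the sign in the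
    denominator, so a branch of \<open>log (-v)\<close> has derivative \<open>1 / v\<close>.\<close>
  have L0': "(L0 has_field_derivative 1 / z) (at z)" if "z \<in> S" for z
    using log_branch_on_has_field_derivative[OF S(1) L(1) that, of "- 1"]
      DERIV_minus[OF DERIV_ident] by fastforce
  have L1': "(L1 has_field_derivative 1 / (z - 1)) (at z)" if "z \<in> S" for z
    using log_branch_on_has_field_derivative[OF S(1) L(2) that, of 1]
      DERIV_diff[OF DERIV_ident DERIV_const] by fastforce
  have h': "(h has_field_derivative h z * \<phi> z) (at z)" if "z \<in> S" for z
    unfolding h_def \<phi>_def
    using DERIV_fun_exp[OF DERIV_add[OF DERIV_cmult[OF L0'[OF that]] DERIV_cmult[OF L1'[OF that]]]]
    by simp
  have \<phi>': "(\<phi> has_field_derivative - (a / v\<^sup>2) - b / (v - 1)\<^sup>2) (at v)"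
    unfolding \<phi>_def
    using nz[OF v] by (auto intro!: derivative_eq_intros simp: power2_eq_square)
  have f': "(f has_field_derivative deriv f z) (at z)" if "z \<in> S" for z
    using S(1) f that by (meson holomorphic_derivI)
  have f'': "(deriv f has_field_derivative deriv (deriv f) v) (at v)"
    using S(1) f v by (meson holomorphic_deriv holomorphic_derivI)
  have d1: "deriv (\<lambda>z. h z * f z) z = h z * (\<phi> z * f z + deriv f z)" if "z \<in> S" for z
    using DERIV_imp_deriv[OF DERIV_mult[OF h'[OF that] f'[OF that]]] by (simp add: algebra_simps)
  have "((\<lambda>z. h z * (\<phi> z * f z + deriv f z)) has_field_derivative
      h v * (\<phi> v * (\<phi> v * f v + deriv f v) + (- (a / v\<^sup>2) - b / (v - 1)\<^sup>2) * f v
        + \<phi> v * deriv f v + deriv (deriv f) v)) (at v)"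
    using DERIV_mult[OF h'[OF v] DERIV_add[OF DERIV_mult[OF \<phi>' f'[OF v]] f'']]
    by (simp add: algebra_simps)
  then have "(deriv (\<lambda>z. h z * f z) has_field_derivative
      h v * (\<phi> v * (\<phi> v * f v + deriv f v) + (- (a / v\<^sup>2) - b / (v - 1)\<^sup>2) * f v
        + \<phi> v * deriv f v + deriv (deriv f) v)) (at v)"
    by (rule has_field_derivative_transform_within_open[OF _ S(1) v]) (simp add: d1)
  then have d2: "deriv (deriv (\<lambda>z. h z * f z)) v =
      h v * (\<phi> v * (\<phi> v * f v + deriv f v) + (- (a / v\<^sup>2) - b / (v - 1)\<^sup>2) * f v
        + \<phi> v * deriv f v + deriv (deriv f) v)"
    by (rule DERIV_imp_deriv)
  \<comment> \<open>In the coordinate \<open>u\<close> the denominators are \<open>u + 1\<close> and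
    \<open>u\<close>, exactly the terms whose nonvanishing is supplied when fractions are
    cleared.\<close>
  define u where "u = v - 1"
  have u: "v = u + 1" "u \<noteq> 0" "u + 1 \<noteq> 0"
    using nz[OF v] by (auto simp: u_def)
  \<comment> \<open>The increment \<open>2 v (1 - v) \<phi>\<close> equals
    \<open>- 2 a (v - 1) - 2 b v\<close>, which shifts \<open>A\<close> by \<open>2 a\<close> and
    \<open>B\<close> by \<open>2 b\<close>.\<close>
  have c1: "2 * v * (1 - v) * \<phi> v - ((1 + A) * (v - 1) + (1 + B) * v) =
      - ((1 + (A + 2 * a)) * (v - 1) + (1 + (B + 2 * b)) * v)"
    using u(2,3) by (simp add: \<phi>_def u(1) divide_simps) algebra
  \<comment> \<open>The residue at \<open>0\<close> is
    \<open>a (a - 1) + (1 + A) a = a (a + A)\<close>, a quarter of \<open>(A + 2 a)^2 - A^2\<close>;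
    the residue at \<open>1\<close> is \<open>- b (b + B)\<close> in the same way.\<close>
  have c0: "v * (1 - v) * ((\<phi> v)\<^sup>2 - a / v\<^sup>2 - b / (v - 1)\<^sup>2)
      - ((1 + A) * (v - 1) + (1 + B) * v) * \<phi> v - 1/4 * (A + B + 1)\<^sup>2 + 1/4 * M\<^sup>2 =
      ((A + 2 * a)\<^sup>2 - A\<^sup>2) / (4 * v) - ((B + 2 * b)\<^sup>2 - B\<^sup>2) / (4 * (v - 1))
        + (M\<^sup>2 - (A + 2 * a + (B + 2 * b) + 1)\<^sup>2) / 4"
    using u(2,3) by (simp add: \<phi>_def u(1) divide_simps) algebra
  have "hyp_op A B M (\<lambda>z. h z * f z) v = h v * (v * (1 - v) * deriv (deriv f) v
      + (2 * v * (1 - v) * \<phi> v - ((1 + A) * (v - 1) + (1 + B) * v)) * deriv f v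
      + (v * (1 - v) * ((\<phi> v)\<^sup>2 - a / v\<^sup>2 - b / (v - 1)\<^sup>2)
        - ((1 + A) * (v - 1) + (1 + B) * v) * \<phi> v - 1/4 * (A + B + 1)\<^sup>2 + 1/4 * M\<^sup>2) * f v)"
    unfolding hyp_op_def hyp_expr_def d2 d1[OF v] by algebra
  also have "\<dots> = h v * gauged_hyp_op (A + 2 * a) (B + 2 * b) A B M f v"
    unfolding c0 c1 gauged_hyp_op_def by (simp add: algebra_simps)
  finally show ?thesis
    by (simp add: h_def)
qed

text \<open>The power left of the hypergeometric operator is the inverse of the one on its right, so
  it cancels the factor produced by the conjugation and only \<open>c\<close> survives. The
  pointwise description of \<open>T\<close> makes the order in which the multiplications are
  composed irrelevant.\<close>

lemma op_eq_on_hyp_op_conjugate: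
  assumes S: "open S" "S \<subseteq> - {0, 1}"
    and L: "log_branch_on S (\<lambda>v. - v) L0" "log_branch_on S (\<lambda>v. v - 1) L1"
    and R: "\<And>f v. f holomorphic_on S \<Longrightarrow> v \<in> S \<Longrightarrow>
      R f v = c v * gauged_hyp_op (A + 2 * a) (B + 2 * b) A B M f v"
    and T: "\<And>f v. T f v = c v * exp (- (a * L0 v + b * L1 v)) *
      hyp_op A B M (\<lambda>z. exp (a * L0 z + b * L1 z) * f z) v"
  shows "op_eq_on S R T"
proof -
  have "R f v = T f v" if "f holomorphic_on S" "v \<in> S" for f v
    using exp_minus_inverse[of "a * L0 v + b * L1 v"]
    unfolding R[OF that] T hyp_op_conjugate[OF S L that] by algebra
  then show ?thesis
    by (simp add: op_eq_on_def)
qed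

section \<open>The six substitutions\<close>

text \<open>For \<open>p = A\<close> and \<open>q = B\<close> the poles of the zeroth order
  coefficient disappear and the hypergeometric operator itself remains. Its exponents are
  \<open>0, - \<alpha>\<close> at \<open>0\<close>, \<open>0, - \<beta>\<close> at \<open>1\<close>
  and \<open>(\<alpha> + \<beta> + 1 \<plusminus> \<mu>) / 2\<close> at infinity; each of the other
  substitutions permutes these pairs along with the three points.\<close>

lemma hyp_op_subst_id:
  assumes "open S" "S \<subseteq> - {0, 1}" "f holomorphic_on S" "v \<in> S"
  shows "hyp_op_subst \<alpha> \<beta> \<mu> (\<lambda>v. v) f v =
    gauged_hyp_op \<alpha> \<beta> \<alpha> \<beta> \<mu> f v"
proof -
  have nz: "z \<noteq> 0" "z - 1 \<noteq> 0" "1 - z \<noteq> 0" if "z \<in> S" for z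
    using assms(2) that by auto
  have r: "((\<lambda>v. 1) has_field_derivative 0) (at v)"
    by (auto intro!: derivative_eq_intros)
  have w: "((\<lambda>v. v) has_field_derivative inverse (1)) (at z)" for z
    by (auto intro!: derivative_eq_intros)
  have d2: "deriv_wrt (\<lambda>v. v) (deriv_wrt (\<lambda>v. v) f) v = deriv (deriv f) v"
    using deriv_wrt_deriv_wrt[OF assms(1,3,4) r w] by simp
  have d1: "deriv_wrt (\<lambda>v. v) f v = deriv f v"
    using DERIV_imp_deriv[OF w] by (simp add: deriv_wrt_def divide_inverse)
  show ?thesis
    unfolding hyp_op_subst_def hyp_expr_def gauged_hyp_op_def d1 d2
    using nz[OF assms(4)] by (simp add: divide_simps) algebra
qed

text \<open>The points \<open>0\<close> and \<open>1\<close> are exchanged and infinity is fixed, so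
  \<open>\<alpha>\<close> and \<open>\<beta>\<close> trade places.\<close>

lemma hyp_op_subst_one_minus:
  assumes "open S" "S \<subseteq> - {0, 1}" "f holomorphic_on S" "v \<in> S"
  shows "hyp_op_subst \<alpha> \<beta> \<mu> (\<lambda>v. 1 - v) f v =
    gauged_hyp_op \<beta> \<alpha> \<beta> \<alpha> \<mu> f v"
proof -
  have nz: "z \<noteq> 0" "z - 1 \<noteq> 0" "1 - z \<noteq> 0" if "z \<in> S" for z
    using assms(2) that by auto
  have r: "((\<lambda>v. -1) has_field_derivative 0) (at v)"
    by (auto intro!: derivative_eq_intros)
  have w: "((\<lambda>v. 1 - v) has_field_derivative inverse (-1)) (at z)" for z
    by (auto intro!: derivative_eq_intros)
  have d2: "deriv_wrt (\<lambda>v. 1 - v) (deriv_wrt (\<lambda>v. 1 - v) f) v = deriv (deriv f) v"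
    using deriv_wrt_deriv_wrt[OF assms(1,3,4) r w] by simp
  have d1: "deriv_wrt (\<lambda>v. 1 - v) f v = - deriv f v"
    using DERIV_imp_deriv[OF w] by (simp add: deriv_wrt_def divide_inverse)
  show ?thesis
    unfolding hyp_op_subst_def hyp_expr_def gauged_hyp_op_def d1 d2
    using nz[OF assms(4)] by (simp add: divide_simps) algebra
qed

text \<open>Now \<open>v = 0\<close> carries the exponents
  \<open>(\<alpha> + \<beta> + 1 \<plusminus> \<mu>) / 2\<close> of \<open>w = \<infinity>\<close>,
  which forces \<open>p = - \<alpha> - \<beta> - 1\<close> and \<open>A = \<mu>\<close>; infinity
  carries those of \<open>w = 0\<close>, hence \<open>M = \<alpha>\<close>. The leading coefficient
  \<open>w (1 - w) / w'^2 = v^2 (v - 1)\<close> accounts for the factor \<open>- v\<close>.\<close>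

lemma hyp_op_subst_inverse:
  assumes "open S" "S \<subseteq> - {0, 1}" "f holomorphic_on S" "v \<in> S"
  shows "hyp_op_subst \<alpha> \<beta> \<mu> (\<lambda>v. 1 / v) f v =
    - v * gauged_hyp_op (- \<alpha> - \<beta> - 1) \<beta> \<mu> \<beta> \<alpha> f v"
proof -
  have nz: "z \<noteq> 0" "z - 1 \<noteq> 0" "1 - z \<noteq> 0" if "z \<in> S" for z
    using assms(2) that by auto
  have r: "((\<lambda>v. - (v\<^sup>2)) has_field_derivative - 2 * v) (at v)"
    by (auto intro!: derivative_eq_intros)
  have w: "((\<lambda>v. 1 / v) has_field_derivative inverse ((\<lambda>v. - (v\<^sup>2)) z)) (at z)" if "z \<in> S" for z
    using nz[OF that]
    by (auto intro!: derivative_eq_intros simp: divide_simps power2_eq_square; algebra)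
  have d2: "deriv_wrt (\<lambda>v. 1 / v) (deriv_wrt (\<lambda>v. 1 / v) f) v =
      (- (v\<^sup>2)) * ((- (v\<^sup>2)) * deriv (deriv f) v + (- 2 * v) * deriv f v)"
    by (rule deriv_wrt_deriv_wrt[OF assms(1,3,4) r w])
  have d1: "deriv_wrt (\<lambda>v. 1 / v) f v = (- (v\<^sup>2)) * deriv f v"
    using DERIV_imp_deriv[OF w[OF assms(4)]] by (simp add: deriv_wrt_def divide_inverse)
  show ?thesis
    unfolding hyp_op_subst_def hyp_expr_def gauged_hyp_op_def d1 d2
    using nz[OF assms(4)] by (simp add: divide_simps) algebra
qed

text \<open>The points \<open>v = 0, 1, \<infinity>\<close> go to
  \<open>w = \<infinity>, 0, 1\<close>, so \<open>A\<close>, \<open>B\<close>, \<open>M\<close>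
  become \<open>\<mu>\<close>, \<open>\<alpha>\<close>, \<open>\<beta>\<close>.\<close>

lemma hyp_op_subst_one_minus_inverse:
  assumes "open S" "S \<subseteq> - {0, 1}" "f holomorphic_on S" "v \<in> S"
  shows "hyp_op_subst \<alpha> \<beta> \<mu> (\<lambda>v. (v - 1) / v) f v =
    - v * gauged_hyp_op (- \<alpha> - \<beta> - 1) \<alpha> \<mu> \<alpha> \<beta> f v"
proof -
  have nz: "z \<noteq> 0" "z - 1 \<noteq> 0" "1 - z \<noteq> 0" if "z \<in> S" for z
    using assms(2) that by auto
  have r: "((\<lambda>v. v\<^sup>2) has_field_derivative 2 * v) (at v)"
    by (auto intro!: derivative_eq_intros)
  have w: "((\<lambda>v. (v - 1) / v) has_field_derivative inverse ((\<lambda>v. v\<^sup>2) z)) (at z)" if "z \<in> S" for z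
    using nz[OF that]
    by (auto intro!: derivative_eq_intros simp: divide_simps power2_eq_square; algebra)
  have d2: "deriv_wrt (\<lambda>v. (v - 1) / v) (deriv_wrt (\<lambda>v. (v - 1) / v) f) v =
      (v\<^sup>2) * ((v\<^sup>2) * deriv (deriv f) v + (2 * v) * deriv f v)"
    by (rule deriv_wrt_deriv_wrt[OF assms(1,3,4) r w])
  have d1: "deriv_wrt (\<lambda>v. (v - 1) / v) f v = (v\<^sup>2) * deriv f v"
    using DERIV_imp_deriv[OF w[OF assms(4)]] by (simp add: deriv_wrt_def divide_inverse)
  show ?thesis
    unfolding hyp_op_subst_def hyp_expr_def gauged_hyp_op_def d1 d2
    using nz[OF assms(4)] by (simp add: divide_simps) algebra
qed

text \<open>The points \<open>v = 0, 1, \<infinity>\<close> go to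
  \<open>w = 1, \<infinity>, 0\<close>. It is now \<open>v = 1\<close> that carries the exponents of
  infinity, so \<open>q\<close> takes the value \<open>- \<alpha> - \<beta> - 1\<close> and the
  leading coefficient \<open>- v (1 - v)^2\<close> gives the factor \<open>v - 1\<close>.\<close>

lemma hyp_op_subst_inverse_one_minus:
  assumes "open S" "S \<subseteq> - {0, 1}" "f holomorphic_on S" "v \<in> S"
  shows "hyp_op_subst \<alpha> \<beta> \<mu> (\<lambda>v. 1 / (1 - v)) f v =
    (v - 1) * gauged_hyp_op \<beta> (- \<alpha> - \<beta> - 1) \<beta> \<mu> \<alpha> f v"
proof -
  have nz: "z \<noteq> 0" "z - 1 \<noteq> 0" "1 - z \<noteq> 0" if "z \<in> S" for z
    using assms(2) that by auto
  have r: "((\<lambda>v. (1 - v)\<^sup>2) has_field_derivative - 2 * (1 - v)) (at v)"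
    by (auto intro!: derivative_eq_intros)
  have w: "((\<lambda>v. 1 / (1 - v)) has_field_derivative inverse ((\<lambda>v. (1 - v)\<^sup>2) z)) (at z)" if "z \<in> S" for z
    using nz[OF that]
    by (auto intro!: derivative_eq_intros simp: divide_simps power2_eq_square; algebra)
  have d2: "deriv_wrt (\<lambda>v. 1 / (1 - v)) (deriv_wrt (\<lambda>v. 1 / (1 - v)) f) v =
      ((1 - v)\<^sup>2) * (((1 - v)\<^sup>2) * deriv (deriv f) v + (- 2 * (1 - v)) * deriv f v)"
    by (rule deriv_wrt_deriv_wrt[OF assms(1,3,4) r w])
  have d1: "deriv_wrt (\<lambda>v. 1 / (1 - v)) f v = ((1 - v)\<^sup>2) * deriv f v"
    using DERIV_imp_deriv[OF w[OF assms(4)]] by (simp add: deriv_wrt_def divide_inverse)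
  show ?thesis
    unfolding hyp_op_subst_def hyp_expr_def gauged_hyp_op_def d1 d2
    using nz[OF assms(4)] by (simp add: divide_simps) algebra
qed

text \<open>The points \<open>v = 0, 1, \<infinity>\<close> go to
  \<open>w = 0, \<infinity>, 1\<close>.\<close>

lemma hyp_op_subst_inverse_one_minus_inverse:
  assumes "open S" "S \<subseteq> - {0, 1}" "f holomorphic_on S" "v \<in> S"
  shows "hyp_op_subst \<alpha> \<beta> \<mu> (\<lambda>v. v / (v - 1)) f v =
    (v - 1) * gauged_hyp_op \<alpha> (- \<alpha> - \<beta> - 1) \<alpha> \<mu> \<beta> f v"
proof -
  have nz: "z \<noteq> 0" "z - 1 \<noteq> 0" "1 - z \<noteq> 0" if "z \<in> S" for z
    using assms(2) that by auto
  have r: "((\<lambda>v. - ((v - 1)\<^sup>2)) has_field_derivative - 2 * (v - 1)) (at v)"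
    by (auto intro!: derivative_eq_intros)
  have w: "((\<lambda>v. v / (v - 1)) has_field_derivative inverse ((\<lambda>v. - ((v - 1)\<^sup>2)) z)) (at z)" if "z \<in> S" for z
    using nz[OF that]
    by (auto intro!: derivative_eq_intros simp: divide_simps power2_eq_square; algebra)
  have d2: "deriv_wrt (\<lambda>v. v / (v - 1)) (deriv_wrt (\<lambda>v. v / (v - 1)) f) v =
      (- ((v - 1)\<^sup>2)) * ((- ((v - 1)\<^sup>2)) * deriv (deriv f) v + (- 2 * (v - 1)) * deriv f v)"
    by (rule deriv_wrt_deriv_wrt[OF assms(1,3,4) r w])
  have d1: "deriv_wrt (\<lambda>v. v / (v - 1)) f v = (- ((v - 1)\<^sup>2)) * deriv f v"
    using DERIV_imp_deriv[OF w[OF assms(4)]] by (simp add: deriv_wrt_def divide_inverse)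
  show ?thesis
    unfolding hyp_op_subst_def hyp_expr_def gauged_hyp_op_def d1 d2
    using nz[OF assms(4)] by (simp add: divide_simps) algebra
qed

section \<open>The twenty-four identities\<close>

theorem mainTheorem1:
  fixes \<alpha> \<beta> \<mu> :: complex
    and \<Omega> :: "complex set"
    and L0 L1 :: "complex \<Rightarrow> complex"
  assumes "open \<Omega>" and "simply_connected \<Omega>" and "\<Omega> \<subseteq> - {0, 1}"
    and "log_branch_on \<Omega> (\<lambda>v. - v) L0"
    and "log_branch_on \<Omega> (\<lambda>v. v - 1) L1"
  shows "
    (\<forall>T \<in> {
        hyp_op \<alpha> \<beta> \<mu>,
        pow_op L0 (- \<alpha>) \<circ> pow_op L1 (- \<beta>) \<circ> hyp_op (- \<alpha>) (- \<beta>) \<mu> \<circ> pow_op L0 \<alpha> \<circ> pow_op L1 \<beta>,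
        pow_op L1 (- \<beta>) \<circ> hyp_op \<alpha> (- \<beta>) (- \<mu>) \<circ> pow_op L1 \<beta>,
        pow_op L0 (- \<alpha>) \<circ> hyp_op (- \<alpha>) \<beta> (- \<mu>) \<circ> pow_op L0 \<alpha>}.
        op_eq_on \<Omega> (hyp_op_subst \<alpha> \<beta> \<mu> (\<lambda>v. v)) T) \<and>
    (\<forall>T \<in> {
        hyp_op \<beta> \<alpha> \<mu>,
        pow_op L1 (- \<alpha>) \<circ> pow_op L0 (- \<beta>) \<circ> hyp_op (- \<beta>) (- \<alpha>) \<mu> \<circ> pow_op L1 \<alpha> \<circ> pow_op L0 \<beta>,
        pow_op L1 (- \<alpha>) \<circ> hyp_op \<beta> (- \<alpha>) (- \<mu>) \<circ> pow_op L1 \<alpha>,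
        pow_op L0 (- \<beta>) \<circ> hyp_op (- \<beta>) \<alpha> (- \<mu>) \<circ> pow_op L0 \<beta>}.
        op_eq_on \<Omega> (hyp_op_subst \<alpha> \<beta> \<mu> (\<lambda>v. 1 - v)) T) \<and>
    (\<forall>T \<in> {
        pow_op L0 ((\<alpha> + \<beta> + \<mu> + 1) / 2) \<circ> mult_op (\<lambda>v. - v) \<circ> hyp_op \<mu> \<beta> \<alpha> \<circ> pow_op L0 ((- \<alpha> - \<beta> - \<mu> - 1) / 2),
        pow_op L0 ((\<alpha> + \<beta> - \<mu> + 1) / 2) \<circ> pow_op L1 (- \<beta>) \<circ> mult_op (\<lambda>v. - v) \<circ> hyp_op (- \<mu>) (- \<beta>) \<alpha> \<circ> pow_op L0 ((- \<alpha> - \<beta> + \<mu> - 1) / 2) \<circ> pow_op L1 \<beta>,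
        pow_op L0 ((\<alpha> + \<beta> + \<mu> + 1) / 2) \<circ> pow_op L1 (- \<beta>) \<circ> mult_op (\<lambda>v. - v) \<circ> hyp_op \<mu> (- \<beta>) (- \<alpha>) \<circ> pow_op L0 ((- \<alpha> - \<beta> - \<mu> - 1) / 2) \<circ> pow_op L1 \<beta>,
        pow_op L0 ((\<alpha> + \<beta> - \<mu> + 1) / 2) \<circ> mult_op (\<lambda>v. - v) \<circ> hyp_op (- \<mu>) \<beta> (- \<alpha>) \<circ> pow_op L0 ((- \<alpha> - \<beta> + \<mu> - 1) / 2)}.
        op_eq_on \<Omega> (hyp_op_subst \<alpha> \<beta> \<mu> (\<lambda>v. 1 / v)) T) \<and>
    (\<forall>T \<in> {
        pow_op L0 ((\<alpha> + \<beta> + \<mu> + 1) / 2) \<circ> mult_op (\<lambda>v. - v) \<circ> hyp_op \<mu> \<alpha> \<beta> \<circ> pow_op L0 ((- \<alpha> - \<beta> - \<mu> - 1) / 2),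
        pow_op L0 ((\<alpha> + \<beta> - \<mu> + 1) / 2) \<circ> pow_op L1 (- \<alpha>) \<circ> mult_op (\<lambda>v. - v) \<circ> hyp_op (- \<mu>) (- \<alpha>) \<beta> \<circ> pow_op L0 ((- \<alpha> - \<beta> + \<mu> - 1) / 2) \<circ> pow_op L1 \<alpha>,
        pow_op L0 ((\<alpha> + \<beta> + \<mu> + 1) / 2) \<circ> pow_op L1 (- \<alpha>) \<circ> mult_op (\<lambda>v. - v) \<circ> hyp_op \<mu> (- \<alpha>) (- \<beta>) \<circ> pow_op L0 ((- \<alpha> - \<beta> - \<mu> - 1) / 2) \<circ> pow_op L1 \<alpha>,
        pow_op L0 ((\<alpha> + \<beta> - \<mu> + 1) / 2) \<circ> mult_op (\<lambda>v. - v) \<circ> hyp_op (- \<mu>) \<alpha> (- \<beta>) \<circ> pow_op L0 ((- \<alpha> - \<beta> + \<mu> - 1) / 2)}.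
        op_eq_on \<Omega> (hyp_op_subst \<alpha> \<beta> \<mu> (\<lambda>v. (v - 1) / v)) T) \<and>
    (\<forall>T \<in> {
        pow_op L1 ((\<alpha> + \<beta> + \<mu> + 1) / 2) \<circ> mult_op (\<lambda>v. v - 1) \<circ> hyp_op \<beta> \<mu> \<alpha> \<circ> pow_op L1 ((- \<alpha> - \<beta> - \<mu> - 1) / 2),
        pow_op L0 (- \<beta>) \<circ> pow_op L1 ((\<alpha> + \<beta> - \<mu> + 1) / 2) \<circ> mult_op (\<lambda>v. v - 1) \<circ> hyp_op (- \<beta>) (- \<mu>) \<alpha> \<circ> pow_op L0 \<beta> \<circ> pow_op L1 ((- \<alpha> - \<beta> + \<mu> - 1) / 2),
        pow_op L1 ((\<alpha> + \<beta> - \<mu> + 1) / 2) \<circ> mult_op (\<lambda>v. v - 1) \<circ> hyp_op \<beta> (- \<mu>) (- \<alpha>) \<circ> pow_op L1 ((- \<alpha> - \<beta> + \<mu> - 1) / 2),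
        pow_op L0 (- \<beta>) \<circ> pow_op L1 ((\<alpha> + \<beta> + \<mu> + 1) / 2) \<circ> mult_op (\<lambda>v. v - 1) \<circ> hyp_op (- \<beta>) \<mu> (- \<alpha>) \<circ> pow_op L0 \<beta> \<circ> pow_op L1 ((- \<alpha> - \<beta> - \<mu> - 1) / 2)}.
        op_eq_on \<Omega> (hyp_op_subst \<alpha> \<beta> \<mu> (\<lambda>v. 1 / (1 - v))) T) \<and>
    (\<forall>T \<in> {
        pow_op L1 ((\<alpha> + \<beta> + \<mu> + 1) / 2) \<circ> mult_op (\<lambda>v. v - 1) \<circ> hyp_op \<alpha> \<mu> \<beta> \<circ> pow_op L1 ((- \<alpha> - \<beta> - \<mu> - 1) / 2),
        pow_op L0 (- \<alpha>) \<circ> pow_op L1 ((\<alpha> + \<beta> - \<mu> + 1) / 2) \<circ> mult_op (\<lambda>v. v - 1) \<circ> hyp_op (- \<alpha>) (- \<mu>) \<beta> \<circ> pow_op L0 \<alpha> \<circ> pow_op L1 ((- \<alpha> - \<beta> + \<mu> - 1) / 2),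
        pow_op L1 ((\<alpha> + \<beta> - \<mu> + 1) / 2) \<circ> mult_op (\<lambda>v. v - 1) \<circ> hyp_op \<alpha> (- \<mu>) (- \<beta>) \<circ> pow_op L1 ((- \<alpha> - \<beta> + \<mu> - 1) / 2),
        pow_op L0 (- \<alpha>) \<circ> pow_op L1 ((\<alpha> + \<beta> + \<mu> + 1) / 2) \<circ> mult_op (\<lambda>v. v - 1) \<circ> hyp_op (- \<alpha>) \<mu> (- \<beta>) \<circ> pow_op L0 \<alpha> \<circ> pow_op L1 ((- \<alpha> - \<beta> - \<mu> - 1) / 2)}.
        op_eq_on \<Omega> (hyp_op_subst \<alpha> \<beta> \<mu> (\<lambda>v. v / (v - 1))) T)"
proof -
  define s t where "s = (\<alpha> + \<beta> + \<mu> + 1) / 2" and "t = (\<alpha> + \<beta> - \<mu> + 1) / 2"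
  have st: "(- \<alpha> - \<beta> - \<mu> - 1) / 2 = - s" "(- \<alpha> - \<beta> + \<mu> - 1) / 2 = - t"
    by (simp_all add: s_def t_def field_simps)
  \<comment> \<open>The exponents \<open>s\<close> and \<open>t\<close> are tuned so that both signs
    of \<open>\<mu>\<close> lead to the same parameter \<open>- \<alpha> - \<beta> - 1\<close> found
    for the four substitutions that move infinity.\<close>
  have st2: "\<mu> - 2 * s = - \<alpha> - \<beta> - 1" "- \<mu> - 2 * t = - \<alpha> - \<beta> - 1"
    by (simp_all add: s_def t_def field_simps)
  note conj = op_eq_on_hyp_op_conjugate[OF assms(1,3,4,5)]
  note ops = comp_def pow_op_def mult_op_def exp_add exp_diff exp_minus field_simps
  show ?thesis
    unfolding st s_def[symmetric] t_def[symmetric] ball_simps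
  proof (intro conjI TrueI)
    show "op_eq_on \<Omega> (hyp_op_subst \<alpha> \<beta> \<mu> (\<lambda>v. v))
        (hyp_op \<alpha> \<beta> \<mu>)"
      \<comment> \<open>Here and below \<open>A\<close>, \<open>B\<close>, \<open>M\<close> are read
        off the conjugated operator, \<open>a\<close> and \<open>b\<close> are the powers of
        \<open>-v\<close> and \<open>v - 1\<close> on its right, with \<open>0\<close> for an absent
        power, and \<open>c\<close> is the remaining factor. The first simplification matches the
        substituted operator with the gauged form, the second one expands the composition.\<close>
      by (rule conj[where A = "\<alpha>" and B = "\<beta>" and M = "\<mu>" and a = "0" and b = "0"
            and c = "\<lambda>v. 1"])
        (simp add: hyp_op_subst_id[OF assms(1,3)] st2, simp add: ops)
    show "op_eq_on \<Omega> (hyp_op_subst \<alpha> \<beta> \<mu> (\<lambda>v. v))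
        (pow_op L0 (- \<alpha>) \<circ> pow_op L1 (- \<beta>) \<circ> hyp_op (- \<alpha>) (- \<beta>) \<mu> \<circ> pow_op L0 \<alpha> \<circ> pow_op L1 \<beta>)"
      \<comment> \<open>A sign flip is compensated by the power:
        \<open>- \<alpha> + 2 * \<alpha> = \<alpha>\<close>, and likewise for
        \<open>\<beta>\<close>.\<close>
      by (rule conj[where A = "- \<alpha>" and B = "- \<beta>" and M = "\<mu>" and a = "\<alpha>" and b = "\<beta>"
            and c = "\<lambda>v. 1"])
        (simp add: hyp_op_subst_id[OF assms(1,3)] st2, simp add: ops)
    show "op_eq_on \<Omega> (hyp_op_subst \<alpha> \<beta> \<mu> (\<lambda>v. v))
        (pow_op L1 (- \<beta>) \<circ> hyp_op \<alpha> (- \<beta>) (- \<mu>) \<circ> pow_op L1 \<beta>)"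
      by (rule conj[where A = "\<alpha>" and B = "- \<beta>" and M = "- \<mu>" and a = "0" and b = "\<beta>"
            and c = "\<lambda>v. 1"])
        (simp add: hyp_op_subst_id[OF assms(1,3)] st2, simp add: ops)
    show "op_eq_on \<Omega> (hyp_op_subst \<alpha> \<beta> \<mu> (\<lambda>v. v))
        (pow_op L0 (- \<alpha>) \<circ> hyp_op (- \<alpha>) \<beta> (- \<mu>) \<circ> pow_op L0 \<alpha>)"
      by (rule conj[where A = "- \<alpha>" and B = "\<beta>" and M = "- \<mu>" and a = "\<alpha>" and b = "0"
            and c = "\<lambda>v. 1"])
        (simp add: hyp_op_subst_id[OF assms(1,3)] st2, simp add: ops)
    show "op_eq_on \<Omega> (hyp_op_subst \<alpha> \<beta> \<mu> (\<lambda>v. 1 - v))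
        (hyp_op \<beta> \<alpha> \<mu>)"
      by (rule conj[where A = "\<beta>" and B = "\<alpha>" and M = "\<mu>" and a = "0" and b = "0"
            and c = "\<lambda>v. 1"])
        (simp add: hyp_op_subst_one_minus[OF assms(1,3)] st2, simp add: ops)
    show "op_eq_on \<Omega> (hyp_op_subst \<alpha> \<beta> \<mu> (\<lambda>v. 1 - v))
        (pow_op L1 (- \<alpha>) \<circ> pow_op L0 (- \<beta>) \<circ> hyp_op (- \<beta>) (- \<alpha>) \<mu> \<circ> pow_op L1 \<alpha> \<circ> pow_op L0 \<beta>)"
      by (rule conj[where A = "- \<beta>" and B = "- \<alpha>" and M = "\<mu>" and a = "\<beta>" and b = "\<alpha>"
            and c = "\<lambda>v. 1"])
        (simp add: hyp_op_subst_one_minus[OF assms(1,3)] st2, simp add: ops)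
    show "op_eq_on \<Omega> (hyp_op_subst \<alpha> \<beta> \<mu> (\<lambda>v. 1 - v))
        (pow_op L1 (- \<alpha>) \<circ> hyp_op \<beta> (- \<alpha>) (- \<mu>) \<circ> pow_op L1 \<alpha>)"
      by (rule conj[where A = "\<beta>" and B = "- \<alpha>" and M = "- \<mu>" and a = "0" and b = "\<alpha>"
            and c = "\<lambda>v. 1"])
        (simp add: hyp_op_subst_one_minus[OF assms(1,3)] st2, simp add: ops)
    show "op_eq_on \<Omega> (hyp_op_subst \<alpha> \<beta> \<mu> (\<lambda>v. 1 - v))
        (pow_op L0 (- \<beta>) \<circ> hyp_op (- \<beta>) \<alpha> (- \<mu>) \<circ> pow_op L0 \<beta>)"
      by (rule conj[where A = "- \<beta>" and B = "\<alpha>" and M = "- \<mu>" and a = "\<beta>" and b = "0"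
            and c = "\<lambda>v. 1"])
        (simp add: hyp_op_subst_one_minus[OF assms(1,3)] st2, simp add: ops)
    show "op_eq_on \<Omega> (hyp_op_subst \<alpha> \<beta> \<mu> (\<lambda>v. 1 / v))
        (pow_op L0 s \<circ> mult_op (\<lambda>v. - v) \<circ> hyp_op \<mu> \<beta> \<alpha> \<circ> pow_op L0 (- s))"
      by (rule conj[where A = "\<mu>" and B = "\<beta>" and M = "\<alpha>" and a = "- s" and b = "0"
            and c = "\<lambda>v. - v"])
        (simp add: hyp_op_subst_inverse[OF assms(1,3)] st2, simp add: ops)
    show "op_eq_on \<Omega> (hyp_op_subst \<alpha> \<beta> \<mu> (\<lambda>v. 1 / v))
        (pow_op L0 t \<circ> pow_op L1 (- \<beta>) \<circ> mult_op (\<lambda>v. - v) \<circ> hyp_op (- \<mu>) (- \<beta>) \<alpha> \<circ> pow_op L0 (- t) \<circ> pow_op L1 \<beta>)"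
      by (rule conj[where A = "- \<mu>" and B = "- \<beta>" and M = "\<alpha>" and a = "- t" and b = "\<beta>"
            and c = "\<lambda>v. - v"])
        (simp add: hyp_op_subst_inverse[OF assms(1,3)] st2, simp add: ops)
    show "op_eq_on \<Omega> (hyp_op_subst \<alpha> \<beta> \<mu> (\<lambda>v. 1 / v))
        (pow_op L0 s \<circ> pow_op L1 (- \<beta>) \<circ> mult_op (\<lambda>v. - v) \<circ> hyp_op \<mu> (- \<beta>) (- \<alpha>) \<circ> pow_op L0 (- s) \<circ> pow_op L1 \<beta>)"
      by (rule conj[where A = "\<mu>" and B = "- \<beta>" and M = "- \<alpha>" and a = "- s" and b = "\<beta>"
            and c = "\<lambda>v. - v"])
        (simp add: hyp_op_subst_inverse[OF assms(1,3)] st2, simp add: ops)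
    show "op_eq_on \<Omega> (hyp_op_subst \<alpha> \<beta> \<mu> (\<lambda>v. 1 / v))
        (pow_op L0 t \<circ> mult_op (\<lambda>v. - v) \<circ> hyp_op (- \<mu>) \<beta> (- \<alpha>) \<circ> pow_op L0 (- t))"
      by (rule conj[where A = "- \<mu>" and B = "\<beta>" and M = "- \<alpha>" and a = "- t" and b = "0"
            and c = "\<lambda>v. - v"])
        (simp add: hyp_op_subst_inverse[OF assms(1,3)] st2, simp add: ops)
    show "op_eq_on \<Omega> (hyp_op_subst \<alpha> \<beta> \<mu> (\<lambda>v. (v - 1) / v))
        (pow_op L0 s \<circ> mult_op (\<lambda>v. - v) \<circ> hyp_op \<mu> \<alpha> \<beta> \<circ> pow_op L0 (- s))"
      by (rule conj[where A = "\<mu>" and B = "\<alpha>" and M = "\<beta>" and a = "- s" and b = "0"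
            and c = "\<lambda>v. - v"])
        (simp add: hyp_op_subst_one_minus_inverse[OF assms(1,3)] st2, simp add: ops)
    show "op_eq_on \<Omega> (hyp_op_subst \<alpha> \<beta> \<mu> (\<lambda>v. (v - 1) / v))
        (pow_op L0 t \<circ> pow_op L1 (- \<alpha>) \<circ> mult_op (\<lambda>v. - v) \<circ> hyp_op (- \<mu>) (- \<alpha>) \<beta> \<circ> pow_op L0 (- t) \<circ> pow_op L1 \<alpha>)"
      by (rule conj[where A = "- \<mu>" and B = "- \<alpha>" and M = "\<beta>" and a = "- t" and b = "\<alpha>"
            and c = "\<lambda>v. - v"])
        (simp add: hyp_op_subst_one_minus_inverse[OF assms(1,3)] st2, simp add: ops)
    show "op_eq_on \<Omega> (hyp_op_subst \<alpha> \<beta> \<mu> (\<lambda>v. (v - 1) / v))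
        (pow_op L0 s \<circ> pow_op L1 (- \<alpha>) \<circ> mult_op (\<lambda>v. - v) \<circ> hyp_op \<mu> (- \<alpha>) (- \<beta>) \<circ> pow_op L0 (- s) \<circ> pow_op L1 \<alpha>)"
      by (rule conj[where A = "\<mu>" and B = "- \<alpha>" and M = "- \<beta>" and a = "- s" and b = "\<alpha>"
            and c = "\<lambda>v. - v"])
        (simp add: hyp_op_subst_one_minus_inverse[OF assms(1,3)] st2, simp add: ops)
    show "op_eq_on \<Omega> (hyp_op_subst \<alpha> \<beta> \<mu> (\<lambda>v. (v - 1) / v))
        (pow_op L0 t \<circ> mult_op (\<lambda>v. - v) \<circ> hyp_op (- \<mu>) \<alpha> (- \<beta>) \<circ> pow_op L0 (- t))"
      by (rule conj[where A = "- \<mu>" and B = "\<alpha>" and M = "- \<beta>" and a = "- t" and b = "0"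
            and c = "\<lambda>v. - v"])
        (simp add: hyp_op_subst_one_minus_inverse[OF assms(1,3)] st2, simp add: ops)
    \<comment> \<open>From here on the preimage of infinity is \<open>v = 1\<close>, so
      \<open>s\<close> and \<open>t\<close> become powers of \<open>v - 1\<close>.\<close>
    show "op_eq_on \<Omega> (hyp_op_subst \<alpha> \<beta> \<mu> (\<lambda>v. 1 / (1 - v)))
        (pow_op L1 s \<circ> mult_op (\<lambda>v. v - 1) \<circ> hyp_op \<beta> \<mu> \<alpha> \<circ> pow_op L1 (- s))"
      by (rule conj[where A = "\<beta>" and B = "\<mu>" and M = "\<alpha>" and a = "0" and b = "- s"
            and c = "\<lambda>v. v - 1"])
        (simp add: hyp_op_subst_inverse_one_minus[OF assms(1,3)] st2, simp add: ops)
    show "op_eq_on \<Omega> (hyp_op_subst \<alpha> \<beta> \<mu> (\<lambda>v. 1 / (1 - v)))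
        (pow_op L0 (- \<beta>) \<circ> pow_op L1 t \<circ> mult_op (\<lambda>v. v - 1) \<circ> hyp_op (- \<beta>) (- \<mu>) \<alpha> \<circ> pow_op L0 \<beta> \<circ> pow_op L1 (- t))"
      by (rule conj[where A = "- \<beta>" and B = "- \<mu>" and M = "\<alpha>" and a = "\<beta>" and b = "- t"
            and c = "\<lambda>v. v - 1"])
        (simp add: hyp_op_subst_inverse_one_minus[OF assms(1,3)] st2, simp add: ops)
    show "op_eq_on \<Omega> (hyp_op_subst \<alpha> \<beta> \<mu> (\<lambda>v. 1 / (1 - v)))
        (pow_op L1 t \<circ> mult_op (\<lambda>v. v - 1) \<circ> hyp_op \<beta> (- \<mu>) (- \<alpha>) \<circ> pow_op L1 (- t))"
      by (rule conj[where A = "\<beta>" and B = "- \<mu>" and M = "- \<alpha>" and a = "0" and b = "- t"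
            and c = "\<lambda>v. v - 1"])
        (simp add: hyp_op_subst_inverse_one_minus[OF assms(1,3)] st2, simp add: ops)
    show "op_eq_on \<Omega> (hyp_op_subst \<alpha> \<beta> \<mu> (\<lambda>v. 1 / (1 - v)))
        (pow_op L0 (- \<beta>) \<circ> pow_op L1 s \<circ> mult_op (\<lambda>v. v - 1) \<circ> hyp_op (- \<beta>) \<mu> (- \<alpha>) \<circ> pow_op L0 \<beta> \<circ> pow_op L1 (- s))"
      by (rule conj[where A = "- \<beta>" and B = "\<mu>" and M = "- \<alpha>" and a = "\<beta>" and b = "- s"
            and c = "\<lambda>v. v - 1"])
        (simp add: hyp_op_subst_inverse_one_minus[OF assms(1,3)] st2, simp add: ops)
    show "op_eq_on \<Omega> (hyp_op_subst \<alpha> \<beta> \<mu> (\<lambda>v. v / (v - 1)))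
        (pow_op L1 s \<circ> mult_op (\<lambda>v. v - 1) \<circ> hyp_op \<alpha> \<mu> \<beta> \<circ> pow_op L1 (- s))"
      by (rule conj[where A = "\<alpha>" and B = "\<mu>" and M = "\<beta>" and a = "0" and b = "- s"
            and c = "\<lambda>v. v - 1"])
        (simp add: hyp_op_subst_inverse_one_minus_inverse[OF assms(1,3)] st2, simp add: ops)
    show "op_eq_on \<Omega> (hyp_op_subst \<alpha> \<beta> \<mu> (\<lambda>v. v / (v - 1)))
        (pow_op L0 (- \<alpha>) \<circ> pow_op L1 t \<circ> mult_op (\<lambda>v. v - 1) \<circ> hyp_op (- \<alpha>) (- \<mu>) \<beta> \<circ> pow_op L0 \<alpha> \<circ> pow_op L1 (- t))"
      by (rule conj[where A = "- \<alpha>" and B = "- \<mu>" and M = "\<beta>" and a = "\<alpha>" and b = "- t"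
            and c = "\<lambda>v. v - 1"])
        (simp add: hyp_op_subst_inverse_one_minus_inverse[OF assms(1,3)] st2, simp add: ops)
    show "op_eq_on \<Omega> (hyp_op_subst \<alpha> \<beta> \<mu> (\<lambda>v. v / (v - 1)))
        (pow_op L1 t \<circ> mult_op (\<lambda>v. v - 1) \<circ> hyp_op \<alpha> (- \<mu>) (- \<beta>) \<circ> pow_op L1 (- t))"
      by (rule conj[where A = "\<alpha>" and B = "- \<mu>" and M = "- \<beta>" and a = "0" and b = "- t"
            and c = "\<lambda>v. v - 1"])
        (simp add: hyp_op_subst_inverse_one_minus_inverse[OF assms(1,3)] st2, simp add: ops)
    show "op_eq_on \<Omega> (hyp_op_subst \<alpha> \<beta> \<mu> (\<lambda>v. v / (v - 1)))
        (pow_op L0 (- \<alpha>) \<circ> pow_op L1 s \<circ> mult_op (\<lambda>v. v - 1) \<circ> hyp_op (- \<alpha>) \<mu> (- \<beta>) \<circ> pow_op L0 \<alpha> \<circ> pow_op L1 (- s))"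
      by (rule conj[where A = "- \<alpha>" and B = "\<mu>" and M = "- \<beta>" and a = "\<alpha>" and b = "- s"
            and c = "\<lambda>v. v - 1"])
        (simp add: hyp_op_subst_inverse_one_minus_inverse[OF assms(1,3)] st2, simp add: ops)
  qed
qed

end
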